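(* Let the admissible triples $(\varepsilon,u_1,u_2)$, their lift coefficient $C_L$ and drag coefficient $C_D$, and the function $J_{\max}$ be as defined in the context. For every given value $C_L\in(0,2/e]$, the global maximum $C_{D\max}$ of the drag coefficient $C_D$ over all admissible triples having that lift coefficient is $$C_{D\max}=\max_{\varepsilon,q_1,q_2}\frac{1}{2\pi}\left\{\sqrt{1-\varepsilon}\,J_{\max}(q_2)+\sqrt{\varepsilon}\,J_{\max}(q_1)\right\}^2,$$ where the maximum is over all real $\varepsilon,q_1,q_2$ satisfying $$\varepsilon\in[0,1),\qquad 0\le q_1,q_2\le \frac1e,\qquad (1-\varepsilon)q_2-\varepsilon q_1=\frac{C_L}{2}.$$
   Context: Here $e$ is the base of natural logarithms and $\log$ is the natural logarithm, with $0\log 0=0$. For a measurable $u:[0,1]\to[0,1]$ define $$I[u]=-\int_0^1u(\sigma)\log u(\sigma)\,d\sigma,\qquad J[u]=-\int_0^1\frac{u(\sigma)\log u(\sigma)}{\sqrt{\int_0^\sigma u(\sigma_1)\,d\sigma_1}}\,d\sigma,$$ the integrand of $J$ being taken as $0$ where $u(\sigma)=0$. An admissible triple $(\varepsilon,u_1,u_2)$ consists of a number $\varepsilon\in[0,1)$ and measurable functions $u_1,u_2:[0,1]\to[0,1]$. Its lift and drag coefficients are $$C_L=2\{(1-\varepsilon)I[u_2]-\varepsilon I[u_1]\},\qquad C_D=\frac{1}{2\pi}\left\{\sqrt{1-\varepsilon}\,J[u_2]+\sqrt{\varepsilon}\,J[u_1]\right\}^2.$$ (These describe a profile in Helmholtz--Kirchhoff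 infinite-cavity flow: $\varepsilon=l_1/l$ is the fraction of the wetted arc length $l$ lying on one side of the stagnation point, $u_1,u_2$ are the surface velocity distributions on the two sides of the stagnation point divided by the velocity at infinity, each as a function of normalized arc length from the stagnation point, and $u_1,u_2\le1$ is the Brillouin condition.) For $q\in[0,1/e]$, $J_{\max}(q)$ denotes the global maximum of $J[u]$ over all measurable $u:[0,1]\to[0,1]$ with $I[u]=q$. (Equivalently, setting $\lambda(\sigma)=\sqrt{2\int_0^\sigma u}$, it is the maximum of $-\sqrt2\int_0^1\lambda'\log(\lambda\lambda')\,d\sigma$ over absolutely continuous $\lambda$ with $\lambda(0)=0$, $\lambda'\ge0$, $\lambda\lambda'\le1$ and $-\int_0^1\lambda\lambda'\log(\lambda\lambda')\,d\sigma=q$.) *)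

theory Defs
  imports "HOL-Analysis.Analysis"
begin

text \<open>
  A measurable function from [0,1] to [0,1] is a total function on the reals of which only the
  values on [0,1] matter; measurability is Lebesgue measurability.
\<close>

definition velocity :: "(real \<Rightarrow> real) \<Rightarrow> bool" where
  "velocity u \<longleftrightarrow>
     u \<in> borel_measurable (lebesgue_on {0..1}) \<and> (\<forall>s\<in>{0..1}. 0 \<le> u s \<and> u s \<le> 1)"

text \<open>
  Wherever \<open>u s = 0\<close> both integrands below evaluate to 0, as required. The points with \<open>u s > 0\<close>
  and a vanishing inner integral form a null set, so the convention \<open>x / 0 = 0\<close> is harmless.
  For each velocity the integrand of \<open>J_functional\<close> is integrable: with
  \<open>- u ln u \<le> C * u powr (3/4)\<close> and the inner integral \<open>U\<close>, Jensen's inequality bounds the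
  integral by the finite quantity \<open>C * (\<integral> u * U powr (- 2/3)) powr (3/4)\<close>.
\<close>

definition I_functional :: "(real \<Rightarrow> real) \<Rightarrow> real" where
  "I_functional u = - (LINT s|lebesgue_on {0..1}. u s * ln (u s))"

definition J_functional :: "(real \<Rightarrow> real) \<Rightarrow> real" where
  "J_functional u =
     - (LINT s|lebesgue_on {0..1}. u s * ln (u s) / sqrt (LINT t|lebesgue_on {0..s}. u t))"

definition admissible :: "real \<Rightarrow> (real \<Rightarrow> real) \<Rightarrow> (real \<Rightarrow> real) \<Rightarrow> bool" where
  "admissible \<epsilon> u1 u2 \<longleftrightarrow> 0 \<le> \<epsilon> \<and> \<epsilon> < 1 \<and> velocity u1 \<and> velocity u2"

definition lift_coeff :: "real \<Rightarrow> (real \<Rightarrow> real) \<Rightarrow> (real \<Rightarrow> real) \<Rightarrow> real" where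
  "lift_coeff \<epsilon> u1 u2 = 2 * ((1 - \<epsilon>) * I_functional u2 - \<epsilon> * I_functional u1)"

definition drag_coeff :: "real \<Rightarrow> (real \<Rightarrow> real) \<Rightarrow> (real \<Rightarrow> real) \<Rightarrow> real" where
  "drag_coeff \<epsilon> u1 u2 =
     1 / (2 * pi) * (sqrt (1 - \<epsilon>) * J_functional u2 + sqrt \<epsilon> * J_functional u1)\<^sup>2"

definition is_maximum :: "real set \<Rightarrow> real \<Rightarrow> bool" where
  "is_maximum S m \<longleftrightarrow> m \<in> S \<and> (\<forall>x\<in>S. x \<le> m)"

definition J_max :: "real \<Rightarrow> real" where
  "J_max q = (THE m. is_maximum {J_functional u | u. velocity u \<and> I_functional u = q} m)"

end

theory Submission
  imports Defs
begin

text \<open>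
  In terms of the cumulated velocity \<open>y = \<integral>\<^sub>0\<^sup>s u\<close> as independent variable and \<open>w = 1 / u\<close> as unknown
  function of \<open>y\<close>, one has \<open>I[u] = \<integral> ln w dy\<close> and \<open>J[u] = \<integral> ln w / sqrt y dy\<close>, while the only
  constraint coming from the interval is \<open>\<integral> w dy \<le> 1\<close>. So both functionals are linear in \<open>ln w\<close>, the
  constraint is convex in it, and for each value of \<open>I\<close> the maximiser of \<open>J\<close> is found by Lagrange
  multipliers: \<open>w\<close> is an affine function of \<open>1 / sqrt y\<close> that equals \<open>e\<close> where \<open>y\<close> ends. These
  maximisers form a curve with parameter \<open>t \<in> [0,1]\<close> (\<open>t / e\<close> being the final value of \<open>y\<close>), along which
  \<open>I\<close> and \<open>J\<close> are continuous and \<open>I\<close> takes every value in \<open>[0, 1/e]\<close>. Both maximum problems of the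
  theorem thus have the value of the maximum of a continuous function of \<open>(\<epsilon>, t1, t2)\<close> on a compact set.
\<close>

section \<open>The primitive of a velocity as integration variable\<close>

abbreviation unit_leb :: "real measure" where
  "unit_leb \<equiv> lebesgue_on {0..1}"

definition primitive :: "(real \<Rightarrow> real) \<Rightarrow> real \<Rightarrow> real" where
  "primitive u s = (LINT t|lebesgue_on {0..s}. u t)"

lemma finite_measure_unit_leb: "finite_measure unit_leb"
  by (rule finite_measure_lebesgue_on) auto

lemma bounded_measurable_imp_integrable_unit_leb:
  fixes f :: "real \<Rightarrow> real"
  assumes "f \<in> borel_measurable unit_leb" "\<And>s. s \<in> {0..1} \<Longrightarrow> \<bar>f s\<bar> \<le> B"
  shows "integrable unit_leb f"
proof (rule finite_measure.integrable_const_bound[OF finite_measure_unit_leb, where B=B])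
  show "AE x in unit_leb. norm (f x) \<le> B"
    by (rule AE_I2) (use assms(2) in auto)
qed (use assms in auto)

lemma velocityD:
  assumes "velocity u"
  shows "u \<in> borel_measurable unit_leb" "s \<in> {0..1} \<Longrightarrow> 0 \<le> u s" "s \<in> {0..1} \<Longrightarrow> u s \<le> 1"
  using assms by (auto simp: velocity_def)

lemma velocity_integrable: "velocity u \<Longrightarrow> integrable unit_leb u"
  by (rule bounded_measurable_imp_integrable_unit_leb[where B=1]) (auto simp: velocity_def)

text \<open>Moving every initial segment to the single measure \<open>unit_leb\<close> lets
  integrals with different upper limits be compared and subtracted.\<close>

lemma integral_initial_segment:
  fixes u :: "real \<Rightarrow> real"
  assumes "s \<in> {0..1}"
  shows "(LINT t|lebesgue_on {0..s}. u t) = (LINT t|unit_leb. indicator {0..s} t * u t)"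
  using assms by (auto simp: integral_restrict_space indicator_def intro!: Bochner_Integration.integral_cong)

lemma integrable_initial_segment:
  assumes "velocity u" "s \<in> {0..1}"
  shows "integrable unit_leb (\<lambda>t. indicator {0..s} t * u t)"
    "integrable (lebesgue_on {0..s}) u"
proof -
  show *: "integrable unit_leb (\<lambda>t. indicator {0..s} t * u t)"
  proof (rule bounded_measurable_imp_integrable_unit_leb[where B=1])
    have "(\<lambda>t. indicator {0..s} t :: real) \<in> borel_measurable unit_leb"
      using assms(2) by (intro borel_measurable_indicator) (auto simp: sets_restrict_space_iff)
    then show "(\<lambda>t. indicator {0..s} t * u t) \<in> borel_measurable unit_leb"
      using velocityD(1)[OF assms(1)] by (rule borel_measurable_times)
  qed (use velocityD(2,3)[OF assms(1)] in \<open>auto simp: indicator_def\<close>)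
  have "(\<lambda>x. indicator {0..1} x *\<^sub>R (indicator {0..s} x * u x)) = (\<lambda>x. indicator {0..s} x *\<^sub>R u x)"
    using assms(2) by (auto simp: indicator_def)
  with * show "integrable (lebesgue_on {0..s}) u"
    by (simp add: integrable_restrict_space)
qed

lemma primitive_0: "primitive u 0 = 0"
  by (simp add: primitive_def integral_restrict_space) (rule integral_eq_zero_AE, rule AE_mp[OF AE_completion[OF AE_lborel_singleton[of 0]]], auto)

lemma primitive_mono:
  assumes u: "velocity u" and "0 \<le> s" "s \<le> t" "t \<le> 1"
  shows "primitive u s \<le> primitive u t"
proof -
  have "(LINT r|unit_leb. indicator {0..s} r * u r) \<le> (LINT r|unit_leb. indicator {0..t} r * u r)"
  proof (rule integral_mono)
    show "indicator {0..s} r * u r \<le> indicator {0..t} r * u r" if "r \<in> space unit_leb" for r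
      using that assms velocityD(2)[OF u, of r] by (auto simp: indicator_def)
  qed (use assms integrable_initial_segment(1)[OF u] in auto)
  then show ?thesis
    using assms integral_initial_segment[of s u] integral_initial_segment[of t u]
    by (simp add: primitive_def)
qed

lemma primitive_nonneg: "velocity u \<Longrightarrow> s \<in> {0..1} \<Longrightarrow> 0 \<le> primitive u s"
  using primitive_mono[of u 0 s] by (simp add: primitive_0)

lemma continuous_on_primitive:
  assumes u: "velocity u"
  shows "continuous_on {0..1} (primitive u)"
proof -
  have "continuous_on {0..1} (\<lambda>s. integral {0..s} u)"
    by (rule indefinite_integral_continuous_1, rule integrable_on_lebesgue_on[OF velocity_integrable[OF u]]) simp
  then show ?thesis
    by (rule continuous_on_eq)
      (simp add: primitive_def lebesgue_integral_eq_integral[OF integrable_initial_segment(2)[OF u]])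
qed

lemma measurable_primitive:
  assumes u: "velocity u"
  shows "primitive u \<in> unit_leb \<rightarrow>\<^sub>M borel"
  by (rule continuous_imp_measurable_on_sets_lebesgue[OF continuous_on_primitive[OF u]]) simp

text \<open>Two measures with equal finite mass on all half-lines agree. By monotonicity the
  preimage of \<open>{x<..}\<close> is, up to one point, an interval from a to 1 where the primitive
  has the value \<open>max 0 x\<close> at a; so the mass of u on it is
  \<open>primitive u 1 - max 0 x\<close>. The primitive may be constant on intervals, hence need not
  be invertible.\<close>

lemma distr_primitive:
  assumes u: "velocity u"
  shows "distr (density unit_leb u) borel (primitive u) =
    density lborel (indicator {0..primitive u 1})"
proof (rule measure_eqI_lessThan)
  let ?V = "primitive u"
  note [measurable] = measurable_primitive[OF u] velocityD(1)[OF u]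
  have l: "emeasure (distr (density unit_leb u) borel ?V) {x<..} = ennreal (?V 1 - max 0 x)"
    if x: "x < ?V 1" for x
  proof -
    \<comment> \<open>For negative x the point is 0; otherwise it is the last point where the
      primitive is at most x, which stays correct if the level x is taken on a whole
      interval.\<close>
    have "\<exists>a\<in>{0..1}. ?V a = max 0 x \<and> (\<forall>s\<in>{0..1}. ?V s > x \<longrightarrow> s \<ge> a) \<and> (\<forall>s\<in>{0..1}. s > a \<longrightarrow> ?V s > x)"
    proof (cases "x < 0")
      case True
      then show ?thesis
        using primitive_nonneg[OF u] by (intro bexI[of _ 0]) (auto simp: primitive_0 max_def less_le_trans)
    next
      case False
      define S where "S = {s\<in>{0..1}. ?V s \<le> x}"
      have "closed S"
        unfolding S_def using continuous_on_primitive[OF u]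
        by (intro continuous_closed_preimage[where T="{..x}", unfolded vimage_def, simplified Int_def, simplified]) auto
      have "S \<noteq> {}"
        using False by (auto simp: S_def primitive_0 intro!: exI[of _ 0])
      moreover have bdd: "bdd_above S"
        by (auto simp: S_def intro!: bdd_aboveI[of _ 1])
      ultimately have a: "Sup S \<in> S"
        using \<open>closed S\<close> closed_contains_Sup by blast
      have up: "s \<le> Sup S" if "s \<in> S" for s
        using that bdd by (rule cSup_upper)
      \<comment> \<open>The intermediate value theorem gives some point of level exactly x. It lies
        in S, hence below \<open>Sup S\<close>, and monotonicity forces the level x at
        \<open>Sup S\<close> too.\<close>
      obtain b where b: "b \<in> {0..1}" "?V b = x"
        using IVT'[of ?V 0 x 1] False x continuous_on_primitive[OF u] by (auto simp: primitive_0)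
      then have "?V b \<le> ?V (Sup S)"
        using a up[of b] by (intro primitive_mono[OF u]) (auto simp: S_def)
      then have "?V (Sup S) = x"
        using a b by (auto simp: S_def)
      moreover have "Sup S \<le> s" if "s \<in> {0..1}" "?V s > x" for s
        using primitive_mono[OF u, of s "Sup S"] that a by (force simp: S_def)
      moreover have "?V s > x" if "s \<in> {0..1}" "s > Sup S" for s
        using up[of s] that by (force simp: S_def)
      ultimately show ?thesis
        using a False by (intro bexI[of _ "Sup S"]) (auto simp: S_def)
    qed
    then obtain a where a: "a \<in> {0..1}" "?V a = max 0 x" "\<And>s. s \<in> {0..1} \<Longrightarrow> ?V s > x \<Longrightarrow> s \<ge> a"
      "\<And>s. s \<in> {0..1} \<Longrightarrow> s > a \<Longrightarrow> ?V s > x"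
      by blast
    have meas: "?V -` {x<..} \<inter> space unit_leb \<in> sets unit_leb"
      by measurable
    have "emeasure (distr (density unit_leb u) borel ?V) {x<..} =
        (\<integral>\<^sup>+ s. ennreal (u s) * indicator (?V -` {x<..} \<inter> space unit_leb) s \<partial>unit_leb)"
      using meas by (simp add: emeasure_distr emeasure_density)
    also have "\<dots> = (\<integral>\<^sup>+ s. ennreal (indicator {0..1} s * u s - indicator {0..a} s * u s) \<partial>unit_leb)"
    \<comment> \<open>The point a is left out because for x < 0 it equals 0 and itself belongs to
      the preimage.\<close>
    proof (rule nn_integral_cong_AE)
      have "AE s in lebesgue. s \<noteq> a"
        by (rule AE_completion[OF AE_lborel_singleton])
      then have "AE s in unit_leb. s \<noteq> a"
        by (auto simp: AE_restrict_space_iff elim: eventually_mono)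
      moreover have "AE s in unit_leb. s \<in> {0..1}"
        by (rule AE_I2) simp
      ultimately show "AE s in unit_leb. ennreal (u s) * indicator (?V -` {x<..} \<inter> space unit_leb) s
         = ennreal (indicator {0..1} s * u s - indicator {0..a} s * u s)"
      proof eventually_elim
        case (elim s)
        then have "?V s > x \<longleftrightarrow> a < s"
          using a(3,4)[of s] by fastforce
        then show ?case
          using elim by (simp add: indicator_def not_less)
      qed
    qed
    also have "\<dots> = ennreal (LINT s|unit_leb. indicator {0..1} s * u s - indicator {0..a} s * u s)"
    proof (rule nn_integral_eq_integral)
      show "AE s in unit_leb. 0 \<le> indicator {0..1} s * u s - indicator {0..a} s * u s"
        by (rule AE_I2) (use a(1) velocityD(2)[OF u] in \<open>auto simp: indicator_def\<close>)
    qed (use integrable_initial_segment(1)[OF u] a(1) in auto)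
    also have "(LINT s|unit_leb. indicator {0..1} s * u s - indicator {0..a} s * u s) = ?V 1 - ?V a"
      using integral_initial_segment[of 1 u] integral_initial_segment[OF a(1), of u]
        integrable_initial_segment(1)[OF u] a(1)
      by (simp add: primitive_def)
    finally show ?thesis
      using a(2) by simp
  qed
  have r: "emeasure (density lborel (indicator {0..?V 1})) {x<..} = ennreal (?V 1 - max 0 x)" for x
  proof -
    have "emeasure (density lborel (indicator {0..?V 1})) {x<..} = emeasure lborel ({0..?V 1} \<inter> {x<..})"
      by (simp add: emeasure_density flip: indicator_inter_arith)
    also have "{0..?V 1} \<inter> {x<..} = (if x < 0 then {0..?V 1} else {x<..?V 1})"
      by auto
    also have "emeasure lborel \<dots> = ennreal (?V 1 - max 0 x)"
      using primitive_nonneg[OF u, of 1]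
      by (cases "x \<le> ?V 1") (auto simp: max_def ennreal_neg)
    finally show ?thesis .
  qed
  have l0: "emeasure (distr (density unit_leb u) borel ?V) {x<..} = 0" if "?V 1 \<le> x" for x
  proof -
    have "?V -` {x<..} \<inter> {0..1} = {}"
      using primitive_mono[OF u, of _ 1] that by force
    then show ?thesis
      by (simp add: emeasure_distr)
  qed
  show eq: "emeasure (distr (density unit_leb u) borel ?V) {x<..} = emeasure (density lborel (indicator {0..?V 1})) {x<..}" for x
    using l[of x] l0[of x] r[of x] by (cases "x < ?V 1") (auto simp: ennreal_neg)
  show "emeasure (distr (density unit_leb u) borel ?V) {x<..} < \<infinity>" for x
    using eq[of x] r[of x] by simp
qed auto

text \<open>The substitution \<open>y = primitive u s\<close>, read off from
  \<open>distr_primitive\<close>: density and image measure each transfer integrability in both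
  directions.\<close>

lemma
  fixes g :: "real \<Rightarrow> real"
  assumes u: "velocity u" and g[measurable]: "g \<in> borel_measurable borel"
  shows integrable_primitive_iff: "integrable unit_leb (\<lambda>s. u s * g (primitive u s)) \<longleftrightarrow>
      integrable lborel (\<lambda>y. indicator {0..primitive u 1} y * g y)"
    and integral_primitive: "(LINT s|unit_leb. u s * g (primitive u s)) =
      (LINT y|lborel. indicator {0..primitive u 1} y * g y)"
proof -
  note [measurable] = measurable_primitive[OF u] velocityD(1)[OF u]
  have nn: "AE s in unit_leb. 0 \<le> u s"
    by (rule AE_I2) (use velocityD(2)[OF u] in auto)
  have [measurable]: "primitive u \<in> density unit_leb u \<rightarrow>\<^sub>M borel"
    by simp
  have D: "density lborel (\<lambda>y. ennreal (indicator {0..primitive u 1} y)) = distr (density unit_leb u) borel (primitive u)"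
    using distr_primitive[OF u] by (simp add: ennreal_indicator)
  have "integrable unit_leb (\<lambda>s. u s * g (primitive u s)) \<longleftrightarrow> 
      integrable (density unit_leb u) (\<lambda>s. g (primitive u s))"
    by (subst integrable_density[OF _ _ nn]) auto
  also have "\<dots> \<longleftrightarrow> integrable (distr (density unit_leb u) borel (primitive u)) g"
    by (simp add: integrable_distr_eq)
  also have "\<dots> \<longleftrightarrow> integrable lborel (\<lambda>y. indicator {0..primitive u 1} y * g y)"
    unfolding D[symmetric] by (subst integrable_density) auto
  finally show "integrable unit_leb (\<lambda>s. u s * g (primitive u s)) \<longleftrightarrow>
      integrable lborel (\<lambda>y. indicator {0..primitive u 1} y * g y)" .
  have "(LINT s|unit_leb. u s * g (primitive u s)) = 
      integral\<^sup>L (density unit_leb u) (\<lambda>s. g (primitive u s))"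
    by (subst integral_density[OF _ _ nn]) auto
  also have "\<dots> = integral\<^sup>L (distr (density unit_leb u) borel (primitive u)) g"
    by (simp add: integral_distr)
  also have "\<dots> = (LINT y|lborel. indicator {0..primitive u 1} y * g y)"
    unfolding D[symmetric] by (subst integral_density) auto
  finally show "(LINT s|unit_leb. u s * g (primitive u s)) =
      (LINT y|lborel. indicator {0..primitive u 1} y * g y)" .
qed

text \<open>The substitution is applied to the indicator of {0}: a single value y = 0 has Lebesgue
  measure zero, so u has no mass where the primitive vanishes. This makes division by its square
  root safe.\<close>

lemma AE_primitive_pos:
  assumes u: "velocity u"
  shows "AE s in unit_leb. u s = 0 \<or> 0 < primitive u s"
proof -
  have [measurable]: "{0} \<in> sets (borel :: real measure)" by simp
  have g: "(indicator {0} :: real \<Rightarrow> real) \<in> borel_measurable borel"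
    by measurable
  have ae: "AE y in lborel. indicator {0..primitive u 1} y * indicator {0} y = (0::real)"
    by (rule AE_mp[OF AE_lborel_singleton[of 0]]) auto
  have "integrable lborel (\<lambda>y. indicator {0..primitive u 1} y * indicator {0} y :: real)
      \<longleftrightarrow> integrable lborel (\<lambda>y::real. 0::real)"
    by (rule integrable_cong_AE) (use ae in auto)
  then have "integrable unit_leb (\<lambda>s. u s * indicator {0} (primitive u s))"
    unfolding integrable_primitive_iff[OF u g] by simp
  moreover have "(LINT s|unit_leb. u s * indicator {0} (primitive u s)) = 0"
    unfolding integral_primitive[OF u g] by (rule integral_eq_zero_AE[OF ae])
  moreover have "AE s in unit_leb. 0 \<le> u s * indicator {0} (primitive u s)"
    by (rule AE_I2) (use velocityD(2)[OF u] in \<open>auto simp: indicator_def\<close>)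
  ultimately have "AE s in unit_leb. u s * indicator {0} (primitive u s) = 0"
    using integral_nonneg_eq_0_iff_AE by blast
  moreover have "AE s in unit_leb. s \<in> {0..1}"
    by (rule AE_I2) simp
  ultimately show ?thesis
    by eventually_elim (use primitive_nonneg[OF u] in \<open>auto simp: indicator_def split: if_splits\<close>, force)
qed

section \<open>The extremal velocities\<close>

text \<open>
  \<open>extremal t\<close> solves \<open>u * slowness t (\<integral>u) = 1\<close>. With \<open>y = (t / e) * x\<^sup>2\<close>, integrating \<open>ds = w dy\<close> gives
  \<open>s = 2 * (1 - t) * x + (2 * t - 1) * x\<^sup>2\<close>; \<open>root_frac t s\<close> is its root \<open>x\<close>, written without the
  singularity at \<open>t = 1 / 2\<close>. The values at \<open>(t, s) = (0, 1)\<close> and \<open>(1, 0)\<close> rely on \<open>x / 0 = 0\<close>.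
\<close>

definition root_rad :: "real \<Rightarrow> real \<Rightarrow> real" where
  "root_rad t s = sqrt ((1 - t)\<^sup>2 * (1 - s) + t\<^sup>2 * s)"

definition root_frac :: "real \<Rightarrow> real \<Rightarrow> real" where
  "root_frac t s = s / (1 - t + root_rad t s)"

definition extremal :: "real \<Rightarrow> real \<Rightarrow> real" where
  "extremal t s = t / exp 1 * root_frac t s / root_rad t s"

definition slowness :: "real \<Rightarrow> real \<Rightarrow> real" where
  "slowness t y = (1 - t) / (sqrt (t / exp 1) * sqrt y) + (2 * t - 1) / (t / exp 1)"

section \<open>Algebra and calculus of the root x and of the extremal velocity\<close>

lemma radicand_nonneg:
  fixes t s :: real
  assumes "s \<in> {0..1}"
  shows "0 \<le> (1 - t)\<^sup>2 * (1 - s) + t\<^sup>2 * s"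
  using assms by (intro add_nonneg_nonneg mult_nonneg_nonneg) auto

lemma root_rad_sq:
  "s \<in> {0..1} \<Longrightarrow> (root_rad t s)\<^sup>2 = (1 - t)\<^sup>2 * (1 - s) + t\<^sup>2 * s"
  by (simp add: root_rad_def radicand_nonneg)

lemma root_rad_nonneg: "s \<in> {0..1} \<Longrightarrow> 0 \<le> root_rad t s"
  by (simp add: root_rad_def radicand_nonneg)

lemma root_rad_pos:
  assumes "0 < t" "0 < s" "s \<le> 1"
  shows "0 < root_rad t s"
  unfolding root_rad_def using assms
  by (auto intro!: add_nonneg_pos mult_nonneg_nonneg)

text \<open>The difference of squares \<open>(root_rad t s)^2 - (1 - t)^2 = (2 * t - 1) * s\<close>
  is divided by \<open>1 - t + root_rad t s\<close>. The result turns the radical into an affine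
  function of x, the same one that appears in the numerator of \<open>slowness\<close>.\<close>

lemma root_rad_eq:
  assumes "0 < t" "t \<le> 1" "s \<in> {0..1}"
  shows "root_rad t s = 1 - t + (2 * t - 1) * root_frac t s"
proof (cases "s = 0")
  case True
  then show ?thesis
    using assms by (simp add: root_rad_def root_frac_def)
next
  case False
  then have pos: "1 - t + root_rad t s > 0"
    using assms root_rad_pos[of t s] by auto
  have "(root_rad t s - (1 - t)) * (1 - t + root_rad t s) = (2 * t - 1) * s"
    using root_rad_sq[OF assms(3), of t] by (simp add: algebra_simps power2_eq_square)
  then show ?thesis
    using pos by (simp add: root_frac_def field_simps)
qed

lemma root_frac_nonneg: "t \<le> 1 \<Longrightarrow> s \<in> {0..1} \<Longrightarrow> 0 \<le> root_frac t s"
  by (simp add: root_frac_def root_rad_nonneg)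

lemma root_frac_pos:
  assumes "0 < t" "t \<le> 1" "0 < s" "s \<le> 1"
  shows "0 < root_frac t s"
  using assms root_rad_pos[of t s] by (simp add: root_frac_def)

lemma root_frac_le_1:
  assumes "0 < t" "t \<le> 1" "s \<in> {0..1}"
  shows "root_frac t s \<le> 1"
proof -
  have "s - (1 - t) \<le> root_rad t s"
  \<comment> \<open>The right square exceeds the left one by exactly
    \<open>s - s * s\<close>.\<close>
  proof (rule power2_le_imp_le)
    have "s * s \<le> s * 1"
      using assms by (intro mult_left_mono) auto
    then show "(s - (1 - t))\<^sup>2 \<le> (root_rad t s)\<^sup>2"
      using root_rad_sq[OF assms(3), of t] by (simp add: algebra_simps power2_eq_square)
  qed (rule root_rad_nonneg[OF assms(3)])
  then have "s \<le> 1 - t + root_rad t s" by simp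
  moreover have "0 \<le> 1 - t + root_rad t s"
    using root_rad_nonneg[OF assms(3), of t] assms by simp
  ultimately show ?thesis
    by (auto simp: root_frac_def divide_le_eq_1)
qed

lemma root_frac_1: "0 \<le> t \<Longrightarrow> root_frac t 1 = 1"
  by (simp add: root_frac_def root_rad_def)

lemma root_frac_0: "root_frac t 0 = 0"
  by (simp add: root_frac_def)

lemma continuous_on_root_frac:
  assumes "0 < t" "t \<le> 1"
  shows "continuous_on {0..1} (root_frac t)"
proof (cases "t = 1")
  \<comment> \<open>Here the denominator vanishes at s = 0, but the quotient is simply
    \<open>sqrt s\<close>.\<close>
  case True
  have "continuous_on {0..1::real} sqrt"
    by (intro continuous_intros)
  then show ?thesis
    by (rule continuous_on_eq) (simp add: True root_frac_def root_rad_def real_div_sqrt)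
next
  case False
  have "1 - t + root_rad t s \<noteq> 0" if "s \<in> {0..1}" for s
    using root_rad_nonneg[OF that, of t] assms False by simp
  then show ?thesis
    unfolding root_frac_def root_rad_def by (intro continuous_intros) auto
qed

text \<open>Since x is an inverse of \<open>s = 2 * (1 - t) * x + (2 * t - 1) * x^2\<close>, its
  derivative must be the reciprocal of \<open>2 * (1 - t) + 2 * (2 * t - 1) * x\<close>, which is
  twice the radical. The quotient rule is used to confirm this.\<close>

lemma has_derivative_root_frac:
  assumes "0 < t" "t \<le> 1" "s \<in> {0<..<1}"
  shows "(root_frac t has_real_derivative 1 / (2 * root_rad t s)) (at s)"
proof -
  have E: "root_rad t s > 0"
    using root_rad_pos[of t s] assms by auto
  then have R: "(1 - t)\<^sup>2 * (1 - s) + t\<^sup>2 * s > 0"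
    by (simp add: root_rad_def)
  have "(root_rad t has_real_derivative (2 * t - 1) / (2 * root_rad t s)) (at s)"
    unfolding root_rad_def using R
    by (auto intro!: derivative_eq_intros simp: field_simps power2_eq_square)
  then have *: "(root_frac t has_real_derivative
     (1 - t + root_rad t s - s * ((2 * t - 1) / (2 * root_rad t s))) / (1 - t + root_rad t s)\<^sup>2) (at s)"
    unfolding root_frac_def using E assms
    by (auto intro!: derivative_eq_intros simp: power2_eq_square)
  \<comment> \<open>Substituting this difference of squares makes the numerator of the quotient rule
    a perfect square, which cancels the denominator.\<close>
  have "s * (2 * t - 1) = (root_rad t s)\<^sup>2 - (1 - t)\<^sup>2"
    using root_rad_sq[of s t] assms by (simp add: algebra_simps power2_eq_square)
  then have "1 - t + root_rad t s - s * ((2 * t - 1) / (2 * root_rad t s)) 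
     = (1 - t + root_rad t s)\<^sup>2 / (2 * root_rad t s)"
    using E by (simp add: field_simps power2_eq_square)
  moreover have "1 - t + root_rad t s \<noteq> 0"
    using E assms by auto
  ultimately show ?thesis
    using * by simp
qed

text \<open>The radical is the convex combination \<open>(1 - t) * (1 - x) + t * x\<close>, so it
  dominates \<open>t * x\<close>; the velocity is thus even at most 1/e.\<close>

lemma extremal_bounds:
  assumes "0 < t" "t \<le> 1" "s \<in> {0..1}"
  shows "0 \<le> extremal t s" "extremal t s \<le> 1"
proof -
  show "0 \<le> extremal t s"
    using assms root_frac_nonneg[of t s] root_rad_nonneg[of s t] by (simp add: extremal_def)
  have "root_rad t s = (1 - t) * (1 - root_frac t s) + t * root_frac t s"
    using root_rad_eq[OF assms] by (simp add: algebra_simps)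
  also have "\<dots> \<ge> t * root_frac t s"
    using assms root_frac_le_1[of t s] by simp
  finally have "t * root_frac t s \<le> root_rad t s" .
  then have "t * root_frac t s / root_rad t s \<le> 1"
    using root_rad_nonneg[of s t] assms by (auto simp: divide_le_eq_1)
  also have "1 \<le> exp (1::real)"
    by simp
  finally have "t * root_frac t s / root_rad t s / exp 1 \<le> 1"
    by (subst divide_le_eq_1_pos) auto
  then show "extremal t s \<le> 1"
    by (simp add: extremal_def mult.commute)
qed

lemma extremal_0: "extremal 0 s = 0"
  by (simp add: extremal_def)

lemma extremal_1: "0 < s \<Longrightarrow> extremal 1 s = 1 / exp 1"
  by (simp add: extremal_def root_frac_def root_rad_def mult.assoc)

lemma velocity_extremal:
  assumes "0 \<le> t" "t \<le> 1"
  shows "velocity (extremal t)"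
proof -
  have "extremal t \<in> borel_measurable borel"
    unfolding extremal_def root_frac_def root_rad_def by measurable
  then have "extremal t \<in> borel_measurable unit_leb"
    by (intro measurable_restrict_space1 measurable_completion) simp
  then show ?thesis
    using assms extremal_bounds[of t] by (cases "t = 0") (auto simp: velocity_def extremal_0)
qed

text \<open>By \<open>has_derivative_root_frac\<close> the derivative of \<open>t / e * x^2\<close>
  is \<open>t / e * x / root_rad t s\<close>. The fundamental theorem is used in its interior form
  because for t = 1 the root \<open>sqrt s\<close> is not differentiable at 0.\<close>

lemma primitive_extremal:
  assumes "0 \<le> t" "t \<le> 1" and s: "s \<in> {0..1}"
  shows "primitive (extremal t) s = t / exp 1 * (root_frac t s)\<^sup>2"
proof (cases "t = 0")
  case True
  then show ?thesis by (simp add: primitive_def extremal_0)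
next
  case False
  then have t: "0 < t" "t \<le> 1"
    using assms by auto
  have "(extremal t has_integral
      (t / exp 1 * (root_frac t s)\<^sup>2 - t / exp 1 * (root_frac t 0)\<^sup>2)) {0..s}"
  proof (rule fundamental_theorem_of_calculus_interior)
    show "continuous_on {0..s} (\<lambda>s. t / exp 1 * (root_frac t s)\<^sup>2)"
      using s by (intro continuous_intros continuous_on_subset[OF continuous_on_root_frac[OF t]]) auto
    show "((\<lambda>s. t / exp 1 * (root_frac t s)\<^sup>2) has_vector_derivative extremal t x) (at x)"
      if "x \<in> {0<..<s}" for x
      unfolding has_real_derivative_iff_has_vector_derivative[symmetric]
      using s that root_rad_pos[of t x] t
      by (auto intro!: derivative_eq_intros has_derivative_root_frac simp: extremal_def field_simps)
  qed (use s in auto)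
  then have "integral {0..s} (extremal t) = t / exp 1 * (root_frac t s)\<^sup>2"
    by (simp add: root_frac_0 integral_unique)
  then show ?thesis
    using lebesgue_integral_eq_integral[OF integrable_initial_segment(2)[OF velocity_extremal s]] assms
    by (simp add: primitive_def)
qed

lemma slowness_primitive_extremal:
  assumes "0 < t" "t \<le> 1" "0 < s" "s \<le> 1"
  shows "0 < primitive (extremal t) s" "0 < extremal t s" 
    "slowness t (primitive (extremal t) s) = 1 / extremal t s"
proof -
  have X: "0 < root_frac t s" "0 < root_rad t s"
    using assms root_frac_pos root_rad_pos by auto
  have U: "primitive (extremal t) s = t / exp 1 * (root_frac t s)\<^sup>2"
    using assms by (intro primitive_extremal) auto
  show "0 < primitive (extremal t) s" "0 < extremal t s"
    using X assms by (auto simp: U extremal_def)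
  have "sqrt (t / exp 1) * sqrt (primitive (extremal t) s) = t / exp 1 * root_frac t s"
    unfolding U real_sqrt_mult mult.assoc[symmetric] using X assms by simp
  then have "slowness t (primitive (extremal t) s) = exp 1 * (1 - t + (2 * t - 1) * root_frac t s) / (t * root_frac t s)"
    unfolding slowness_def by (simp only:) (use X assms in \<open>simp add: field_simps\<close>)
  also have "\<dots> = exp 1 * root_rad t s / (t * root_frac t s)"
    using root_rad_eq[of t s] assms by simp
  finally show "slowness t (primitive (extremal t) s) = 1 / extremal t s"
    by (simp add: extremal_def)
qed

text \<open>With \<open>m = sqrt (t / e)\<close> and \<open>r = sqrt y\<close> the slowness is
  \<open>(1 - t) / (m * r) + (2 * t - 1) / m^2\<close>. It decreases in r to the value
  \<open>t / m^2 = e\<close> at r = m; and replacing m by r and \<open>2 * t - 1\<close> by t bounds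
  it by \<open>1 / r^2\<close>. The lower bound gives the sign of \<open>dual_potential\<close>, the
  upper one a majorant independent of t.\<close>

lemma slowness_bounds:
  assumes "0 < t" "t \<le> 1" "0 < y" "y \<le> t / exp 1"
  shows "exp 1 \<le> slowness t y" "slowness t y \<le> 1 / y"
proof -
  define m where "m = sqrt (t / exp 1)"
  have m: "0 < m" "m\<^sup>2 = t / exp 1"
    using assms by (auto simp: m_def)
  define r where "r = sqrt y"
  have r: "0 < r" "r \<le> m" "y = (r)\<^sup>2"
    using assms by (auto simp: m_def r_def)
  have le: "m * r \<le> m\<^sup>2" "(r)\<^sup>2 \<le> m * r" "0 < (r)\<^sup>2" "0 < m * r" "0 < m\<^sup>2"
    unfolding power2_eq_square
    using mult_left_mono[OF r(2), of m] mult_right_mono[OF r(2), of "r"] m(1) r(1) by auto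
  have w: "slowness t y = (1 - t) / (m * r) + (2 * t - 1) / m\<^sup>2"
    by (simp add: slowness_def m(2)) (simp add: m_def r_def)
  have "exp 1 = (1 - t) / m\<^sup>2 + (2 * t - 1) / m\<^sup>2"
    using assms(1) by (simp add: m(2) field_simps)
  also have "(1 - t) / m\<^sup>2 \<le> (1 - t) / (m * r)"
    by (rule divide_left_mono) (use le assms in auto)
  finally show "exp 1 \<le> slowness t y"
    by (simp add: w)
  have "(1 - t) / (m * r) \<le> (1 - t) / (r)\<^sup>2"
    by (rule divide_left_mono) (use le assms in auto)
  moreover have "(2 * t - 1) / m\<^sup>2 \<le> t / m\<^sup>2"
    using assms by (intro divide_right_mono) auto
  moreover have "t / m\<^sup>2 \<le> t / (r)\<^sup>2"
    by (rule divide_left_mono) (use le assms in auto)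
  ultimately have "slowness t y \<le> (1 - t) / (r)\<^sup>2 + t / (r)\<^sup>2"
    unfolding w by linarith
  also have "\<dots> = 1 / y"
    using r(3) by (simp add: add_divide_distrib[symmetric])
  finally show "slowness t y \<le> 1 / y" .
qed

lemma measurable_slowness[measurable]: "slowness t \<in> borel_measurable borel"
  unfolding slowness_def by measurable

lemma AE_unit_leb_pos: "AE s in unit_leb. 0 < s \<and> s \<le> 1"
proof -
  have "AE s in lebesgue. s \<noteq> (0::real)"
    by (rule AE_completion[OF AE_lborel_singleton])
  then have "AE s in unit_leb. s \<noteq> 0"
    by (auto simp: AE_restrict_space_iff elim: eventually_mono)
  moreover have "AE s in unit_leb. s \<in> {0..1}"
    by (rule AE_I2) simp
  ultimately show ?thesis
    by eventually_elim auto
qed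

lemma measurable_velocity_primitive:
  assumes u: "velocity u" and [measurable]: "k \<in> borel_measurable borel"
  shows "(\<lambda>s. u s * ln (u s) * k (primitive u s)) \<in> borel_measurable unit_leb"
proof -
  note [measurable] = measurable_primitive[OF u] velocityD(1)[OF u]
  show ?thesis by measurable
qed

text \<open>Along an extremal \<open>- ln u\<close> equals \<open>ln (slowness t y)\<close> with y
  the primitive, so the substitution applies. The weight \<open>k y = 1\<close> yields I and
  \<open>k y = 1 / sqrt y\<close> yields J.\<close>

lemma
  fixes k :: "real \<Rightarrow> real"
  assumes t: "0 \<le> t" "t \<le> 1" and k[measurable]: "k \<in> borel_measurable borel"
  shows integrable_extremal_iff: "integrable unit_leb (\<lambda>s. extremal t s * ln (extremal t s) * k (primitive (extremal t) s)) \<longleftrightarrow>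
      integrable lborel (\<lambda>y. indicator {0..t / exp 1} y * (ln (slowness t y) * k y))"
    and integral_extremal: "- (LINT s|unit_leb. extremal t s * ln (extremal t s) * k (primitive (extremal t) s)) =
      (LINT y|lborel. indicator {0..t / exp 1} y * (ln (slowness t y) * k y))"
proof -
  let ?u = "extremal t" and ?g = "\<lambda>y. ln (slowness t y) * k y"
  have u: "velocity ?u"
    using t by (rule velocity_extremal)
  have g: "?g \<in> borel_measurable borel"
    by measurable
  have U1: "primitive ?u 1 = t / exp 1"
    using primitive_extremal[of t 1] t by (simp add: root_frac_1)
  have ae: "AE s in unit_leb. ?u s * ?g (primitive ?u s) = - (?u s * ln (?u s) * k (primitive ?u s))"
    using AE_unit_leb_pos
  proof eventually_elim
    case (elim s)
    show ?case
    proof (cases "t = 0")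
      case False
      then show ?thesis
        using slowness_primitive_extremal[of t s] t elim by (simp add: ln_div)
    qed (simp add: extremal_0)
  qed
  note [measurable] = measurable_velocity_primitive[OF u k] measurable_primitive[OF u] velocityD(1)[OF u]
  have "integrable unit_leb (\<lambda>s. ?u s * ?g (primitive ?u s)) \<longleftrightarrow>
      integrable unit_leb (\<lambda>s. - (?u s * ln (?u s) * k (primitive ?u s)))"
    by (rule integrable_cong_AE[OF _ _ ae]) measurable
  then show "integrable unit_leb (\<lambda>s. ?u s * ln (?u s) * k (primitive ?u s)) \<longleftrightarrow>
      integrable lborel (\<lambda>y. indicator {0..t / exp 1} y * ?g y)"
    using integrable_primitive_iff[OF u g] by (simp add: U1)
  have "(LINT s|unit_leb. ?u s * ?g (primitive ?u s)) =
      (LINT s|unit_leb. - (?u s * ln (?u s) * k (primitive ?u s)))"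
    by (rule integral_cong_AE[OF _ _ ae]) measurable
  then show "- (LINT s|unit_leb. ?u s * ln (?u s) * k (primitive ?u s)) =
      (LINT y|lborel. indicator {0..t / exp 1} y * ?g y)"
    using integral_primitive[OF u g] by (simp add: U1)
qed

section \<open>The functionals along the extremals\<close>

text \<open>The upper bound is \<open>ln z <= z - 1\<close> at \<open>z = 1 / (e * x)\<close>, and
  equality there forces z = 1.\<close>

lemma entropy_bounds:
  fixes x :: real
  assumes "0 \<le> x" "x \<le> 1"
  shows "0 \<le> - (x * ln x)" "- (x * ln x) \<le> 1 / exp 1"
    "- (x * ln x) = 1 / exp 1 \<Longrightarrow> x = 1 / exp 1"
proof -
  show "0 \<le> - (x * ln x)"
    using assms by (cases "x = 0") (auto simp: mult_nonneg_nonpos)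
  have eq: "ln (1 / (exp 1 * x)) = - ln x - 1" if "0 < x"
    using that by (simp add: ln_div ln_mult)
  show "- (x * ln x) \<le> 1 / exp 1"
  proof (cases "x = 0")
    case False
    then have "- ln x - 1 \<le> 1 / (exp 1 * x) - 1"
      using eq assms ln_le_minus_one[of "1 / (exp 1 * x)"] by simp
    then show ?thesis
      using False assms by (simp add: field_simps)
  qed simp
  show "x = 1 / exp 1" if h: "- (x * ln x) = 1 / exp 1"
  proof -
    have "x \<noteq> 0"
      using h by auto
    then have x: "0 < x"
      using assms by simp
    then have "- ln x = 1 / (exp 1 * x)"
      using h by (simp add: field_simps)
    then have "1 / (exp 1 * x) = 1"
      using eq[OF x] x by (intro ln_eq_minus_one) auto
    then show ?thesis
      using x by (simp add: field_simps)
  qed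
qed

lemma entropy_integrable:
  assumes "velocity u"
  shows "integrable unit_leb (\<lambda>s. u s * ln (u s))"
proof (rule bounded_measurable_imp_integrable_unit_leb)
  note [measurable] = velocityD(1)[OF assms]
  show "(\<lambda>s. u s * ln (u s)) \<in> borel_measurable unit_leb"
    by measurable
  show "\<bar>u s * ln (u s)\<bar> \<le> 1 / exp 1" if "s \<in> {0..1}" for s
    using entropy_bounds(1,2)[of "u s"] velocityD(2,3)[OF assms that] by linarith
qed

lemma I_functional_nonneg:
  assumes "velocity u"
  shows "0 \<le> I_functional u"
  unfolding I_functional_def integral_minus[symmetric]
  by (rule integral_nonneg_AE, rule AE_I2) (use entropy_bounds(1) velocityD[OF assms] in auto)

lemma J_functional_primitive:
  "J_functional u = - (LINT s|unit_leb. u s * ln (u s) / sqrt (primitive u s))"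
  by (simp add: J_functional_def primitive_def)

lemma J_functional_nonneg:
  assumes "velocity u"
  shows "0 \<le> J_functional u"
  unfolding J_functional_primitive integral_minus[symmetric]
proof (rule integral_nonneg_AE, rule AE_I2)
  fix s assume "s \<in> space unit_leb"
  then have "s \<in> {0..1}" by simp
  then have "0 \<le> - (u s * ln (u s)) / sqrt (primitive u s)"
    using entropy_bounds(1)[of "u s"] velocityD[OF assms] primitive_nonneg[OF assms]
    by (intro divide_nonneg_nonneg) auto
  then show "0 \<le> - (u s * ln (u s) / sqrt (primitive u s))" by simp
qed

lemma measure_unit_leb: "measure unit_leb (space unit_leb) = 1"
  by (simp add: measure_restrict_space)

text \<open>The nonnegative function \<open>1 / e + u * ln u\<close> is integrated over a space of
  measure 1; a vanishing integral forces it to vanish almost everywhere. The two equality cases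
  settle the endpoints of the parameter range, to which the multiplier argument does not
  extend.\<close>

lemma
  assumes u: "velocity u"
  shows I_functional_le: "I_functional u \<le> 1 / exp 1"
    and I_functional_eq_max: "I_functional u = 1 / exp 1 \<Longrightarrow> AE s in unit_leb. u s = 1 / exp 1"
    and I_functional_eq_0: "I_functional u = 0 \<Longrightarrow> AE s in unit_leb. u s * ln (u s) = 0"
proof -
  have int: "integrable unit_leb (\<lambda>s. 1 / exp 1 + u s * ln (u s))"
    by (intro Bochner_Integration.integrable_add entropy_integrable[OF u]
        finite_measure.integrable_const finite_measure_unit_leb)
  have eq: "(LINT s|unit_leb. 1 / exp 1 + u s * ln (u s)) = 1 / exp 1 - I_functional u"
    using entropy_integrable[OF u] measure_unit_leb finite_measure_unit_leb
    by (subst Bochner_Integration.integral_add)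
       (auto simp: I_functional_def finite_measure.integrable_const)
  have nn: "AE s in unit_leb. 0 \<le> 1 / exp 1 + u s * ln (u s)"
    by (rule AE_I2) (use entropy_bounds(2)[of "u _"] velocityD(2,3)[OF u] in force)
  show "I_functional u \<le> 1 / exp 1"
    using integral_nonneg_AE[OF nn] eq by simp
  have in01: "AE s in unit_leb. s \<in> {0..1}"
    by (rule AE_I2) simp
  show "AE s in unit_leb. u s = 1 / exp 1" if "I_functional u = 1 / exp 1"
  proof -
    have "AE s in unit_leb. 1 / exp 1 + u s * ln (u s) = 0"
      using integral_nonneg_eq_0_iff_AE[OF int nn] eq that by simp
    then show ?thesis
      using in01 by eventually_elim (use entropy_bounds(3) velocityD(2,3)[OF u] in force)
  qed
  show "AE s in unit_leb. u s * ln (u s) = 0" if "I_functional u = 0"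
  proof -
    have "AE s in unit_leb. 0 \<le> - (u s * ln (u s))"
      by (rule AE_I2) (use entropy_bounds(1) velocityD(2,3)[OF u] in auto)
    then have "AE s in unit_leb. - (u s * ln (u s)) = 0"
      using integral_nonneg_eq_0_iff_AE[of unit_leb "\<lambda>s. - (u s * ln (u s))"] entropy_integrable[OF u] that
      by (simp add: I_functional_def)
    then show ?thesis by simp
  qed
qed

section \<open>A majorant uniform in t, and continuity of I and J along the extremals\<close>

lemma integrable_powr_unit_interval:
  fixes a :: real
  assumes "-1 < a"
  shows "integrable lborel (\<lambda>y. indicator {0..1} y * y powr a)"
proof -
  have "(\<lambda>y. y powr a) absolutely_integrable_on {0..1}"
    using has_integral_powr_from_0[OF assms, of 1] by (intro nonnegative_absolutely_integrable_1) auto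
  then show ?thesis
    by (simp add: set_integrable_def integrable_completion)
qed

text \<open>From \<open>slowness t y <= 1 / y\<close> and \<open>ln z <= 4 * z powr (1/4)\<close>
  the logarithm costs only \<open>y powr (-1/4)\<close>; together with \<open>1 / sqrt y\<close> the
  exponent is -3/4, still integrable at 0.\<close>

lemma ln_slowness_bound:
  assumes "0 \<le> t" "t \<le> 1" "y \<noteq> 0" and k: "\<And>y. 0 < y \<Longrightarrow> y \<le> 1 \<Longrightarrow> \<bar>k y\<bar> \<le> 1 / sqrt y"
  shows "\<bar>indicator {0..t / exp 1} y * (ln (slowness t y) * k y)\<bar>
    \<le> 4 * (indicator {0..1} y * y powr (-3/4))"
proof (cases "y \<in> {0..t / exp 1}")
  case True
  then have y: "0 < y" "y \<le> t / exp 1"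
    using assms(3) by auto
  moreover have "0 < t"
    using y by (cases "t = 0") (use assms in auto)
  ultimately have w: "exp 1 \<le> slowness t y" "slowness t y \<le> 1 / y"
    using slowness_bounds[of t y] assms by auto
  have "t / exp 1 \<le> 1 / 1"
    using assms by (intro frac_le) auto
  with y(2) have y1: "y \<le> 1" by linarith
  have w1: "1 \<le> slowness t y"
    using w(1) one_le_exp_iff[of "1::real"] by linarith
  have "0 \<le> ln (slowness t y)"
    using w1 by simp
  moreover have "ln (slowness t y) \<le> ln (1 / y)"
    using w1 w(2) y by (subst ln_le_cancel_iff) auto
  moreover have "ln (1 / y) \<le> (1 / y) powr (1 / 4) / (1 / 4)"
    using y y1 by (intro ln_powr_bound) auto
  moreover have "(1 / y) powr (1 / 4) = y powr (-1/4)"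
    using y powr_minus_divide[of y "1/4"] by (simp add: powr_divide)
  ultimately have "\<bar>ln (slowness t y)\<bar> \<le> 4 * y powr (-1/4)"
    by simp
  moreover have "\<bar>k y\<bar> \<le> y powr (-1/2)"
    using k[OF y(1) y1] y powr_minus_divide[of y "1/2"] by (simp add: powr_half_sqrt)
  ultimately have "\<bar>ln (slowness t y) * k y\<bar> \<le> 4 * y powr (-1/4) * y powr (-1/2)"
    unfolding abs_mult by (intro mult_mono) auto
  also have "\<dots> = 4 * y powr (-3/4)"
    by (simp add: mult.assoc flip: powr_add)
  finally show ?thesis
    using y y1 by simp
qed simp

lemma integrable_ln_slowness:
  assumes t: "0 \<le> t" "t \<le> 1" and [measurable]: "k \<in> borel_measurable borel"
    and k: "\<And>y. 0 < y \<Longrightarrow> y \<le> 1 \<Longrightarrow> \<bar>k y\<bar> \<le> 1 / sqrt y"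
  shows "integrable lborel (\<lambda>y. indicator {0..t / exp 1} y * (ln (slowness t y) * k y))"
proof (rule Bochner_Integration.integrable_bound)
  show "integrable lborel (\<lambda>y. 4 * (indicator {0..1} y * y powr (-3/4)) :: real)"
    by (intro integrable_mult_right integrable_powr_unit_interval) simp
  show "AE y in lborel. norm (indicator {0..t / exp 1} y * (ln (slowness t y) * k y))
      \<le> norm (4 * (indicator {0..1} y * y powr (-3/4)) :: real)"
    using AE_lborel_singleton[of 0]
  proof eventually_elim
    case (elim y)
    then show ?case
      using ln_slowness_bound[OF t elim k] by simp
  qed
qed measurable

text \<open>Dominated convergence with the majorant above. The integrand converges at every y except
  possibly 0 and \<open>a / exp 1\<close>, where the indicator of the limit jumps. For a = 0 all
  positive y fall under the case where the integrand is eventually 0.\<close>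

lemma continuous_on_integral_ln_slowness:
  assumes [measurable]: "k \<in> borel_measurable borel"
    and k: "\<And>y. 0 < y \<Longrightarrow> y \<le> 1 \<Longrightarrow> \<bar>k y\<bar> \<le> 1 / sqrt y"
  shows "continuous_on {0..1} (\<lambda>t. LINT y|lborel. indicator {0..t / exp 1} y * (ln (slowness t y) * k y))"
proof (rule continuous_on_sequentiallyI)
  fix u :: "nat \<Rightarrow> real" and a :: real
  assume u: "\<forall>n. u n \<in> {0..1}" and a: "a \<in> {0..1}" and lim: "u \<longlonglongrightarrow> a"
  have lim': "(\<lambda>n. u n / exp 1) \<longlonglongrightarrow> a / exp 1"
    using lim by (intro tendsto_intros) auto
  show "(\<lambda>n. LINT y|lborel. indicator {0..u n / exp 1} y * (ln (slowness (u n) y) * k y)) \<longlonglongrightarrow>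
      (LINT y|lborel. indicator {0..a / exp 1} y * (ln (slowness a y) * k y))"
  proof (rule integral_dominated_convergence[where w="\<lambda>y. 4 * (indicator {0..1} y * y powr (-3/4))"])
    show "integrable lborel (\<lambda>y. 4 * (indicator {0..1} y * y powr (-3/4)) :: real)"
      by (intro integrable_mult_right integrable_powr_unit_interval) simp
    show "AE y in lborel. norm (indicator {0..u n / exp 1} y * (ln (slowness (u n) y) * k y))
      \<le> 4 * (indicator {0..1} y * y powr (-3/4))" for n
      using AE_lborel_singleton[of 0]
    proof eventually_elim
      case (elim y)
      then show ?case
        using ln_slowness_bound[OF _ _ elim k, of "u n"] u by simp
    qed
    show "AE y in lborel. (\<lambda>n. indicator {0..u n / exp 1} y * (ln (slowness (u n) y) * k y))
        \<longlonglongrightarrow> indicator {0..a / exp 1} y * (ln (slowness a y) * k y)"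
      using AE_lborel_singleton[of 0] AE_lborel_singleton[of "a / exp 1"]
    proof eventually_elim
      case (elim y)
      consider "y < 0" | "a / exp 1 < y" | "0 < y" "y < a / exp 1"
        using elim by linarith
      then show ?case
      proof cases
        case 1
        then show ?thesis by simp
      next
        case 2
        have ev: "eventually (\<lambda>n. u n / exp 1 < y) sequentially"
          using lim' 2 by (rule order_tendstoD)
        have "(\<lambda>n. indicator {0..u n / exp 1} y * (ln (slowness (u n) y) * k y)) \<longlonglongrightarrow> 0"
          by (rule tendsto_eventually, rule eventually_mono[OF ev]) auto
        then show ?thesis
          using 2 by simp
      next
        case 3
        have "0 < a"
          using 3 by (cases "a = 0") (use a in auto)
        then have "exp 1 \<le> slowness a y"
          using slowness_bounds(1)[of a y] 3 a by auto
        then have "0 < slowness a y"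
          using exp_gt_zero[of "1::real"] by linarith
        moreover have "(\<lambda>n. slowness (u n) y) \<longlonglongrightarrow> slowness a y"
          unfolding slowness_def using \<open>0 < a\<close> 3 by (intro tendsto_intros lim) auto
        ultimately have *: "(\<lambda>n. ln (slowness (u n) y) * k y) \<longlonglongrightarrow> ln (slowness a y) * k y"
          by (intro tendsto_intros) auto
        have "eventually (\<lambda>n. y < u n / exp 1) sequentially"
          using lim' 3(2) by (rule order_tendstoD)
        then have "eventually (\<lambda>n. ln (slowness (u n) y) * k y =
            indicator {0..u n / exp 1} y * (ln (slowness (u n) y) * k y)) sequentially"
          by (rule eventually_mono) (use 3 in auto)
        with * have "(\<lambda>n. indicator {0..u n / exp 1} y * (ln (slowness (u n) y) * k y))
            \<longlonglongrightarrow> ln (slowness a y) * k y"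
          by (rule Lim_transform_eventually)
        then show ?thesis
          using 3 by simp
      qed
    qed
  qed measurable
qed

lemma I_functional_extremal:
  assumes "0 \<le> t" "t \<le> 1"
  shows "I_functional (extremal t) = (LINT y|lborel. indicator {0..t / exp 1} y * (ln (slowness t y) * 1))"
  using integral_extremal[OF assms, of "\<lambda>_. 1"] by (simp add: I_functional_def)

lemma J_functional_extremal:
  assumes "0 \<le> t" "t \<le> 1"
  shows "J_functional (extremal t) =
    (LINT y|lborel. indicator {0..t / exp 1} y * (ln (slowness t y) * (1 / sqrt y)))"
  using integral_extremal[OF assms, of "\<lambda>y. 1 / sqrt y"]
  by (simp add: J_functional_primitive)

lemma abs_one_le_inverse_sqrt: "0 < y \<Longrightarrow> y \<le> 1 \<Longrightarrow> \<bar>1\<bar> \<le> 1 / sqrt (y::real)"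
  by simp

lemma abs_inverse_sqrt_le: "0 < y \<Longrightarrow> \<bar>1 / sqrt y\<bar> \<le> 1 / sqrt (y::real)"
  by simp

lemma continuous_on_I_functional_extremal: "continuous_on {0..1} (\<lambda>t. I_functional (extremal t))"
  by (rule continuous_on_eq[OF continuous_on_integral_ln_slowness[where k="\<lambda>_. 1"]])
    (auto simp: I_functional_extremal)

lemma continuous_on_J_functional_extremal: "continuous_on {0..1} (\<lambda>t. J_functional (extremal t))"
  by (rule continuous_on_eq[OF continuous_on_integral_ln_slowness[where k="\<lambda>y. 1 / sqrt y"]])
    (auto simp: J_functional_extremal)

section \<open>Optimality of the extremals\<close>

text \<open>This is \<open>ln z <= z - 1\<close> at \<open>z = 1 / (v * w)\<close>, scaled by
  \<open>v * w\<close>. Equality holds when \<open>v * w = 1\<close>, which is the relation between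
  velocity and slowness on an extremal.\<close>

lemma fenchel_young_entropy:
  fixes v w :: real
  assumes "0 < v" "0 < w"
  shows "- (v * ln v) * w \<le> 1 + v * (w * ln w - w)"
proof -
  have "ln (1 / (v * w)) \<le> 1 / (v * w) - 1"
    using assms by (intro ln_le_minus_one) auto
  then have "v * w * (- ln v - ln w) \<le> v * w * (1 / (v * w) - 1)"
    using assms by (intro mult_left_mono) (auto simp: ln_div ln_mult)
  also have "\<dots> = 1 - v * w"
    using assms by (simp add: field_simps)
  finally show ?thesis
    by (simp add: algebra_simps)
qed

text \<open>The bracket of \<open>fenchel_young_entropy\<close> with w the slowness. At
  \<open>y = t / exp 1\<close> the slowness is e and the bracket is 0, so the cut-off there is
  continuous.\<close>

definition dual_potential :: "real \<Rightarrow> real \<Rightarrow> real" where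
  "dual_potential t y = indicator {0..t / exp 1} y * (slowness t y * ln (slowness t y) - slowness t y)"

lemma dual_potential_nonneg:
  assumes "0 < t" "t \<le> 1" "y \<noteq> 0"
  shows "0 \<le> dual_potential t y"
proof (cases "y \<in> {0..t / exp 1}")
  case True
  then have w: "exp 1 \<le> slowness t y"
    using slowness_bounds assms by auto
  then have w0: "0 < slowness t y"
    using exp_gt_zero[of "1::real"] by linarith
  then have "1 \<le> ln (slowness t y)"
    using w by (simp add: ln_ge_iff)
  then show ?thesis
    using w0 by (simp add: dual_potential_def)
qed (simp add: dual_potential_def)

lemma measurable_dual_potential[measurable]: "dual_potential t \<in> borel_measurable borel"
  unfolding dual_potential_def by measurable

text \<open>The potential lies between 0 and \<open>w * ln w\<close>, and the latter is a linear
  combination of the integrands of J and I because w is affine in \<open>1 / sqrt y\<close>.\<close>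

lemma integrable_dual_potential:
  assumes t: "0 < t" "t \<le> 1"
  shows "integrable lborel (dual_potential t)"
proof (rule Bochner_Integration.integrable_bound)
  let ?i = "\<lambda>y. indicator {0..t / exp 1} y * (ln (slowness t y) * 1)"
  let ?j = "\<lambda>y. indicator {0..t / exp 1} y * (ln (slowness t y) * (1 / sqrt y))"
  let ?f = "\<lambda>y. (1 - t) / sqrt (t / exp 1) * ?j y + (2 * t - 1) / (t / exp 1) * ?i y"
  show "integrable lborel ?f"
    using t abs_one_le_inverse_sqrt abs_inverse_sqrt_le
    by (intro Bochner_Integration.integrable_add integrable_mult_right integrable_ln_slowness) auto
  have f: "?f y = indicator {0..t / exp 1} y * (slowness t y * ln (slowness t y))" for y
    by (simp add: slowness_def algebra_simps)
  show "AE y in lborel. norm (dual_potential t y) \<le> norm (?f y)"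
    using AE_lborel_singleton[of 0]
  proof eventually_elim
    case (elim y)
    show ?case
    proof (cases "y \<in> {0..t / exp 1}")
      case True
      then have y: "0 < y" "y \<le> t / exp 1"
        using elim by auto
      then have "exp 1 \<le> slowness t y"
        using t slowness_bounds by auto
      then have "0 < slowness t y"
        using exp_gt_zero[of "1::real"] by linarith
      moreover have "0 \<le> dual_potential t y"
        using dual_potential_nonneg t y by auto
      ultimately show ?thesis
        unfolding f using y by (simp add: dual_potential_def)
    qed (simp add: dual_potential_def)
  qed
qed measurable

lemma
  assumes t: "0 < t" "t < 1" and v: "velocity v"
    and int: "integrable unit_leb (\<lambda>s. v s * ln (v s) / sqrt (primitive v s))"
  shows integrable_slowness_entropy: "integrable unit_leb (\<lambda>s. - (v s * ln (v s)) * slowness t (primitive v s))"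
    and combination_eq: "(1 - t) / sqrt (t / exp 1) * J_functional v + (2 * t - 1) / (t / exp 1) * I_functional v =
      (LINT s|unit_leb. - (v s * ln (v s)) * slowness t (primitive v s))"
proof -
  let ?a = "(1 - t) / sqrt (t / exp 1)" and ?b = "(2 * t - 1) / (t / exp 1)"
  have f: "- (v s * ln (v s)) * slowness t (primitive v s) =
      - (?a * (v s * ln (v s) / sqrt (primitive v s)) + ?b * (v s * ln (v s)))" for s
  proof -
    \<comment> \<open>The identity also holds for r = 0 with \<open>x / 0 = 0\<close>, so zeros of
      the primitive cause no case distinction.\<close>
    have "- x * (a / (b * r) + c) = - (a / b * (x / r) + c * x)" for a b c r x :: real
      by (simp add: algebra_simps)
    then show ?thesis
      unfolding slowness_def .
  qed
  note i = integrable_mult_right[OF int, of ?a] integrable_mult_right[OF entropy_integrable[OF v], of ?b]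
  show "integrable unit_leb (\<lambda>s. - (v s * ln (v s)) * slowness t (primitive v s))"
    unfolding f by (intro Bochner_Integration.integrable_minus Bochner_Integration.integrable_add i)
  show "?a * J_functional v + ?b * I_functional v =
      (LINT s|unit_leb. - (v s * ln (v s)) * slowness t (primitive v s))"
    unfolding f integral_minus Bochner_Integration.integral_add[OF i] J_functional_primitive I_functional_def
      integral_mult_right_zero
    by simp
qed

text \<open>
  Weak duality: \<open>(1 - t) / sqrt (t / e)\<close> and \<open>(2 * t - 1) / (t / e)\<close> are the coefficients of \<open>1 / sqrt y\<close> and
  \<open>1\<close> in \<open>slowness t y\<close>.
\<close>

lemma combination_le:
  assumes t: "0 < t" "t < 1" and v: "velocity v"
    and int: "integrable unit_leb (\<lambda>s. v s * ln (v s) / sqrt (primitive v s))"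
  shows "(1 - t) / sqrt (t / exp 1) * J_functional v + (2 * t - 1) / (t / exp 1) * I_functional v
    \<le> 1 + (LINT y|lborel. dual_potential t y)"
proof -
  let ?V = "primitive v" and ?P = "dual_potential t"
  have iP: "integrable lborel ?P"
    using t by (intro integrable_dual_potential) auto
  then have iP': "integrable lborel (\<lambda>y. indicator {0..?V 1} y * ?P y)"
    using integrable_mult_indicator[of "{0..?V 1}" lborel ?P] by simp
  then have iV: "integrable unit_leb (\<lambda>s. v s * ?P (?V s))"
    by (subst integrable_primitive_iff[OF v]) auto
  have ae: "AE s in unit_leb. - (v s * ln (v s)) * slowness t (?V s) \<le> 1 + v s * ?P (?V s)"
    using AE_primitive_pos[OF v] AE_unit_leb_pos
  proof eventually_elim
    case (elim s)
    show ?case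
    proof (cases "v s = 0")
      case False
      then have V: "0 < ?V s" and v0: "0 < v s" "v s \<le> 1"
        using elim velocityD(2,3)[OF v, of s] by auto
      show ?thesis
      proof (cases "?V s \<le> t / exp 1")
        case True
        then have "exp 1 \<le> slowness t (?V s)"
          using slowness_bounds(1)[of t "?V s"] V t by auto
        then have "0 < slowness t (?V s)"
          using exp_gt_zero[of "1::real"] by linarith
        then show ?thesis
          using fenchel_young_entropy[OF v0(1)] True V by (simp add: dual_potential_def)
      next
        case False
        \<comment> \<open>Beyond the cut-off the slowness is at most e and the entropy density lies
          between 0 and 1/e, so the product is at most 1, the constant term of the bound.\<close>
        have M: "0 < sqrt (t / exp 1)" "sqrt (t / exp 1) * sqrt (t / exp 1) = t / exp 1"
          using t by auto
        have "(1 - t) / (sqrt (t / exp 1) * sqrt (?V s)) \<le> (1 - t) / (sqrt (t / exp 1) * sqrt (t / exp 1))"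
          using False t V by (intro divide_left_mono mult_left_mono mult_pos_pos) auto
        then have "slowness t (?V s) \<le> (1 - t) / (t / exp 1) + (2 * t - 1) / (t / exp 1)"
          unfolding slowness_def M(2) by simp
        also have "\<dots> = exp 1"
          using t by (simp add: field_simps)
        finally have "- (v s * ln (v s)) * slowness t (?V s) \<le> - (v s * ln (v s)) * exp 1"
          using entropy_bounds(1)[of "v s"] v0 by (intro mult_left_mono) auto
        also have "\<dots> \<le> 1 / exp 1 * exp 1"
          using entropy_bounds(2)[of "v s"] v0 by (intro mult_right_mono) auto
        finally show ?thesis
          using False by (simp add: dual_potential_def)
      qed
    qed simp
  qed
  have "(1 - t) / sqrt (t / exp 1) * J_functional v + (2 * t - 1) / (t / exp 1) * I_functional v
      = (LINT s|unit_leb. - (v s * ln (v s)) * slowness t (?V s))"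
    by (rule combination_eq[OF t v int])
  also have "\<dots> \<le> (LINT s|unit_leb. 1 + v s * ?P (?V s))"
    using iV by (intro integral_mono_AE[OF integrable_slowness_entropy[OF t v int] _ ae]
        Bochner_Integration.integrable_add finite_measure.integrable_const finite_measure_unit_leb)
  also have "\<dots> = 1 + (LINT y|lborel. indicator {0..?V 1} y * ?P y)"
    using iV measure_unit_leb finite_measure_unit_leb
    by (subst Bochner_Integration.integral_add)
      (auto simp: finite_measure.integrable_const integral_primitive[OF v])
  \<comment> \<open>The final value of the primitive depends on v; nonnegativity of the potential
    removes this dependence.\<close>
  also have "(LINT y|lborel. indicator {0..?V 1} y * ?P y) \<le> (LINT y|lborel. ?P y)"
  proof (rule integral_mono_AE[OF iP' iP])
    show "AE y in lborel. indicator {0..?V 1} y * ?P y \<le> ?P y"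
      using AE_lborel_singleton[of 0]
    proof eventually_elim
      case (elim y)
      then show ?case
        using dual_potential_nonneg[of t y] t by (auto simp: indicator_def)
    qed
  qed
  finally show ?thesis by simp
qed

lemma integrable_J_extremal:
  assumes "0 \<le> t" "t \<le> 1"
  shows "integrable unit_leb (\<lambda>s. extremal t s * ln (extremal t s) / sqrt (primitive (extremal t) s))"
proof -
  have "integrable unit_leb (\<lambda>s. extremal t s * ln (extremal t s) * (1 / sqrt (primitive (extremal t) s)))"
    using integrable_ln_slowness[OF assms, of "\<lambda>y. 1 / sqrt y"]
    by (subst integrable_extremal_iff[OF assms]) auto
  then show ?thesis by simp
qed

text \<open>Both inequalities behind \<open>combination_le\<close> are equalities here: velocity
  times slowness is 1, and the primitive ends exactly at \<open>t / exp 1\<close>, where the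
  potential is cut off.\<close>

lemma combination_extremal:
  assumes t: "0 < t" "t < 1"
  shows "(1 - t) / sqrt (t / exp 1) * J_functional (extremal t) + (2 * t - 1) / (t / exp 1) * I_functional (extremal t)
    = 1 + (LINT y|lborel. dual_potential t y)"
proof -
  let ?u = "extremal t" and ?P = "dual_potential t"
  let ?U = "primitive ?u"
  have u: "velocity ?u"
    using t by (intro velocity_extremal) auto
  have U1: "?U 1 = t / exp 1"
    using primitive_extremal[of t 1] t by (simp add: root_frac_1)
  have P: "indicator {0..?U 1} y * ?P y = ?P y" for y
    by (cases "y \<in> {0..t / exp 1}") (simp_all add: U1 dual_potential_def)
  have iV: "integrable unit_leb (\<lambda>s. ?u s * ?P (?U s))"
    using t integrable_dual_potential[of t] by (subst integrable_primitive_iff[OF u]) (auto simp: P)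
  note [measurable] = measurable_primitive[OF u] velocityD(1)[OF u]
  have ae: "AE s in unit_leb. - (?u s * ln (?u s)) * slowness t (?U s) = 1 + ?u s * ?P (?U s)"
    using AE_unit_leb_pos
  proof eventually_elim
    case (elim s)
    then have "?U s \<le> t / exp 1"
      using primitive_mono[OF u, of s 1] by (simp add: U1)
    moreover have w: "slowness t (?U s) = 1 / ?u s" "0 < ?u s" "0 < ?U s"
      using slowness_primitive_extremal[of t s] t elim by auto
    ultimately have "?P (?U s) = 1 / ?u s * ln (1 / ?u s) - 1 / ?u s"
      by (simp add: dual_potential_def)
    then show ?case
      unfolding w(1) using w(2) by (simp add: ln_div right_diff_distrib)
  qed
  have "(1 - t) / sqrt (t / exp 1) * J_functional ?u + (2 * t - 1) / (t / exp 1) * I_functional ?u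
      = (LINT s|unit_leb. - (?u s * ln (?u s)) * slowness t (?U s))"
    using t by (intro combination_eq u integrable_J_extremal) auto
  also have "\<dots> = (LINT s|unit_leb. 1 + ?u s * ?P (?U s))"
    by (rule integral_cong_AE[OF _ _ ae]) measurable
  also have "\<dots> = 1 + (LINT y|lborel. ?P y)"
    using iV measure_unit_leb finite_measure_unit_leb
    by (subst Bochner_Integration.integral_add)
      (auto simp: finite_measure.integrable_const integral_primitive[OF u] P)
  finally show ?thesis .
qed

section \<open>The endpoints of the parameter range and the value of \<open>J_max\<close>\<close>

lemma I_functional_extremal_0: "I_functional (extremal 0) = 0"
  by (simp add: I_functional_def extremal_0)

lemma I_functional_extremal_1: "I_functional (extremal 1) = 1 / exp 1"
proof -
  have u: "velocity (extremal 1)"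
    by (rule velocity_extremal) auto
  note [measurable] = velocityD(1)[OF u]
  have ae: "AE s in unit_leb. extremal 1 s * ln (extremal 1 s) = - 1 / exp 1"
    using AE_unit_leb_pos by eventually_elim (simp add: extremal_1 ln_div)
  have "(LINT s|unit_leb. extremal 1 s * ln (extremal 1 s)) = (LINT s|unit_leb. - 1 / exp 1)"
    by (rule integral_cong_AE[OF _ _ ae]) measurable
  also have "\<dots> = - 1 / exp 1"
    using measure_unit_leb by simp
  finally show ?thesis
    by (simp add: I_functional_def)
qed

lemma primitive_cong_AE:
  assumes u: "velocity u" and v: "velocity v" and ae: "AE s in unit_leb. u s = v s"
    and s: "s \<in> {0..1}"
  shows "primitive u s = primitive v s"
proof -
  have "(LINT t|unit_leb. indicator {0..s} t * u t) = (LINT t|unit_leb. indicator {0..s} t * v t)"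
    using integrable_initial_segment(1)[OF u s] integrable_initial_segment(1)[OF v s]
    by (intro integral_cong_AE) (use ae in auto)
  then show ?thesis
    using integral_initial_segment[OF s, of u] integral_initial_segment[OF s, of v]
    by (simp add: primitive_def)
qed

lemma J_functional_cong_AE:
  assumes u: "velocity u" and v: "velocity v" and ae: "AE s in unit_leb. u s = v s"
  shows "J_functional u = J_functional v"
proof -
  note [measurable] = measurable_primitive[OF u] velocityD(1)[OF u]
    measurable_primitive[OF v] velocityD(1)[OF v]
  have "(LINT s|unit_leb. u s * ln (u s) / sqrt (primitive u s)) =
      (LINT s|unit_leb. v s * ln (v s) / sqrt (primitive v s))"
  proof (rule integral_cong_AE)
    show "AE s in unit_leb. u s * ln (u s) / sqrt (primitive u s) = v s * ln (v s) / sqrt (primitive v s)"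
      using ae AE_unit_leb_pos by eventually_elim (simp add: primitive_cong_AE[OF u v ae])
  qed measurable
  then show ?thesis
    by (simp add: J_functional_primitive)
qed

text \<open>For 0 < t < 1 weak duality and its equality case compare the same combination of J and
  I; the I terms cancel and the coefficient of J is positive. At t = 1 that coefficient vanishes and
  at t = 0 it degenerates, so there the equality cases of the bounds on I are used:
  \<open>I = 0\<close> gives J = 0, and \<open>I = 1 / e\<close> determines v almost
  everywhere.\<close>

lemma J_functional_le_extremal:
  assumes t: "0 \<le> t" "t \<le> 1" and v: "velocity v" and I: "I_functional v = I_functional (extremal t)"
  shows "J_functional v \<le> J_functional (extremal t)"
proof -
  have u: "velocity (extremal t)"
    using t by (rule velocity_extremal)
  note [measurable] = measurable_primitive[OF v] velocityD(1)[OF v]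
  consider "t = 0" | "t = 1" | "0 < t" "t < 1"
    using t by linarith
  then show ?thesis
  proof cases
    case 1
    then have ae: "AE s in unit_leb. v s * ln (v s) = 0"
      using I_functional_eq_0[OF v] I I_functional_extremal_0 by simp
    have "(LINT s|unit_leb. v s * ln (v s) / sqrt (primitive v s)) = 0"
      by (rule integral_eq_zero_AE) (use ae in eventually_elim, auto)
    then show ?thesis
      using J_functional_nonneg[OF u] by (simp add: J_functional_primitive)
  next
    case 2
    then have "AE s in unit_leb. v s = 1 / exp 1"
      using I_functional_eq_max[OF v] I I_functional_extremal_1 by simp
    then have "AE s in unit_leb. v s = extremal t s"
      using AE_unit_leb_pos by eventually_elim (simp add: 2 extremal_1)
    then show ?thesis
      using J_functional_cong_AE[OF v u] by simp
  next
    case 3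
    show ?thesis
    proof (cases "integrable unit_leb (\<lambda>s. v s * ln (v s) / sqrt (primitive v s))")
      case True
      then have "(1 - t) / sqrt (t / exp 1) * J_functional v \<le> (1 - t) / sqrt (t / exp 1) * J_functional (extremal t)"
        using combination_le[OF 3 v] combination_extremal[OF 3] I by simp
      then show ?thesis
        using 3 by (subst (asm) mult_le_cancel_left_pos) auto
    next
      case False \<comment> \<open>excluded in fact, but then the Bochner integral is 0 by convention\<close>
      then have "J_functional v = 0"
        by (simp add: J_functional_primitive not_integrable_integral_eq)
      then show ?thesis
        using J_functional_nonneg[OF u] by simp
    qed
  qed
qed

lemma is_maximum_unique: "is_maximum S m \<Longrightarrow> is_maximum S m' \<Longrightarrow> m = m'"
  by (force simp: is_maximum_def intro: antisym)

lemma J_max_extremal: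
  assumes "0 \<le> t" "t \<le> 1"
  shows "J_max (I_functional (extremal t)) = J_functional (extremal t)"
proof -
  have "is_maximum {J_functional u | u. velocity u \<and> I_functional u = I_functional (extremal t)}
      (J_functional (extremal t))"
    using velocity_extremal[OF assms] J_functional_le_extremal[OF assms] by (auto simp: is_maximum_def)
  then show ?thesis
    unfolding J_max_def using is_maximum_unique by (intro the_equality)
qed

text \<open>The continuous function I runs from 0 at t = 0 to 1/e at t = 1, so
  \<open>J_max_extremal\<close> covers every q in that range.\<close>

lemma ex_extremal:
  assumes "0 \<le> q" "q \<le> 1 / exp 1"
  obtains t where "t \<in> {0..1}" "I_functional (extremal t) = q"
  using IVT'[of "\<lambda>t. I_functional (extremal t)" 0 q 1] assms continuous_on_I_functional_extremal
  by (auto simp: I_functional_extremal_0 I_functional_extremal_1)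

section \<open>The maximal drag\<close>

theorem mainTheorem3:
  fixes CL :: real
  assumes "0 < CL" and "CL \<le> 2 / exp 1"
  shows "\<exists>CDmax.
    is_maximum {drag_coeff \<epsilon> u1 u2 | \<epsilon> u1 u2.
      admissible \<epsilon> u1 u2 \<and> lift_coeff \<epsilon> u1 u2 = CL} CDmax \<and>
    is_maximum {1 / (2 * pi) * (sqrt (1 - \<epsilon>) * J_max q2 + sqrt \<epsilon> * J_max q1)\<^sup>2 | \<epsilon> q1 q2.
      0 \<le> \<epsilon> \<and> \<epsilon> < 1 \<and> 0 \<le> q1 \<and> q1 \<le> 1 / exp 1 \<and> 0 \<le> q2 \<and> q2 \<le> 1 / exp 1 \<and>
      (1 - \<epsilon>) * q2 - \<epsilon> * q1 = CL / 2} CDmax"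
proof -
  let ?I = "\<lambda>t. I_functional (extremal t)" and ?J = "\<lambda>t. J_functional (extremal t)"
  define B where "B = {0..1::real} \<times> {0..1::real} \<times> {0..1::real}"
  define F where "F = (\<lambda>(\<epsilon>, t1, t2). 1 / (2 * pi) * (sqrt (1 - \<epsilon>) * ?J t2 + sqrt \<epsilon> * ?J t1)\<^sup>2)"
  define G where "G = (\<lambda>(\<epsilon>, t1, t2). (1 - \<epsilon>) * ?I t2 - \<epsilon> * ?I t1)"
  define K where "K = {p \<in> B. G p = CL / 2}"
  have vel: "velocity (extremal t)" if "t \<in> {0..1}" for t
    using that velocity_extremal by auto
  have "compact B"
    unfolding B_def by (intro compact_Times compact_Icc)
  have cont: "continuous_on B (\<lambda>p. f (fst (snd p)))" "continuous_on B (\<lambda>p. f (snd (snd p)))"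
    if "continuous_on {0..1} f" for f :: "real \<Rightarrow> real"
    by (rule continuous_on_compose2[OF that]; auto intro!: continuous_intros simp: B_def)+
  note c = cont[OF continuous_on_I_functional_extremal] cont[OF continuous_on_J_functional_extremal]
  have "continuous_on B F" "continuous_on B G"
    unfolding F_def G_def case_prod_unfold by (intro continuous_intros c)+
  have "closed K"
    unfolding K_def
    using continuous_closed_preimage_constant[OF \<open>continuous_on B G\<close> compact_imp_closed[OF \<open>compact B\<close>]] .
  then have "compact K"
    using compact_Int_closed[OF \<open>compact B\<close>, of K] by (simp add: K_def Int_def conj_left_commute)
  have "0 \<le> CL / 2" "CL / 2 \<le> 1 / exp 1"
    using assms by auto
  then obtain t0 where "t0 \<in> {0..1}" "?I t0 = CL / 2"
    by (rule ex_extremal)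
  then have "(0, 0, t0) \<in> K"
    \<comment> \<open>With the first coordinate 0 the whole lift comes from the second side, and the
      parameter of the first side is arbitrary.\<close>
    by (simp add: K_def B_def G_def)
  then have "K \<noteq> {}" by auto
  have "continuous_on K F"
    using \<open>continuous_on B F\<close> by (rule continuous_on_subset) (auto simp: K_def)
  then obtain p where "p \<in> K" and p: "\<And>x. x \<in> K \<Longrightarrow> F x \<le> F p"
    using continuous_attains_sup[OF \<open>compact K\<close> \<open>K \<noteq> {}\<close>] by blast
  obtain \<epsilon> t1 t2 where p_eq: "p = (\<epsilon>, t1, t2)"
    by (cases p)
  have mem: "\<epsilon> \<in> {0..1}" "t1 \<in> {0..1}" "t2 \<in> {0..1}" "(1 - \<epsilon>) * ?I t2 - \<epsilon> * ?I t1 = CL / 2"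
    using \<open>p \<in> K\<close> by (auto simp: p_eq K_def B_def G_def)
  \<comment> \<open>At 1 the constraint would read \<open>- ?I t1 = CL / 2\<close>, contradicting a
    positive lift.\<close>
  have "\<epsilon> \<noteq> 1"
    using mem assms(1) I_functional_nonneg[OF vel[OF mem(2)]] by auto
  then have "\<epsilon> < 1"
    using mem by auto
  show ?thesis
  proof (intro exI conjI)
    show "is_maximum {drag_coeff \<epsilon> u1 u2 | \<epsilon> u1 u2.
      admissible \<epsilon> u1 u2 \<and> lift_coeff \<epsilon> u1 u2 = CL} (F p)"
      unfolding is_maximum_def
    proof safe
      show "\<exists>\<epsilon>' u1 u2. F p = drag_coeff \<epsilon>' u1 u2 \<and> admissible \<epsilon>' u1 u2 \<and> lift_coeff \<epsilon>' u1 u2 = CL"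
        using mem \<open>\<epsilon> < 1\<close> vel
        by (intro exI[of _ \<epsilon>] exI[of _ "extremal t1"] exI[of _ "extremal t2"])
          (auto simp: F_def p_eq drag_coeff_def admissible_def lift_coeff_def)
    next
      fix e u1 u2
      assume adm: "admissible e u1 u2" and CL: "CL = lift_coeff e u1 u2"
      then have e: "0 \<le> e" "e < 1" and u: "velocity u1" "velocity u2"
        by (auto simp: admissible_def)
      \<comment> \<open>Each velocity is replaced by an extremal with the same I. This keeps the
        lift, while J does not decrease on either side; as all J are nonnegative, the squared sum
        does not decrease either.\<close>
      obtain r1 where r1: "r1 \<in> {0..1}" "?I r1 = I_functional u1"
        using ex_extremal[OF I_functional_nonneg I_functional_le] u(1) by metis
      obtain r2 where r2: "r2 \<in> {0..1}" "?I r2 = I_functional u2"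
        using ex_extremal[OF I_functional_nonneg I_functional_le] u(2) by metis
      have "(e, r1, r2) \<in> K"
        using e r1 r2 CL by (auto simp: K_def B_def G_def lift_coeff_def)
      have "J_functional u1 \<le> ?J r1" "J_functional u2 \<le> ?J r2"
        using J_functional_le_extremal r1 r2 u by auto
      then have "drag_coeff e u1 u2 \<le> F (e, r1, r2)"
        unfolding drag_coeff_def F_def prod.case using e J_functional_nonneg u
        by (intro mult_left_mono power_mono add_mono add_nonneg_nonneg mult_nonneg_nonneg) auto
      also have "\<dots> \<le> F p"
        by (rule p) fact
      finally show "drag_coeff e u1 u2 \<le> F p" .
    qed
    show "is_maximum {1 / (2 * pi) * (sqrt (1 - \<epsilon>) * J_max q2 + sqrt \<epsilon> * J_max q1)\<^sup>2 | \<epsilon> q1 q2.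
      0 \<le> \<epsilon> \<and> \<epsilon> < 1 \<and> 0 \<le> q1 \<and> q1 \<le> 1 / exp 1 \<and> 0 \<le> q2 \<and> q2 \<le> 1 / exp 1 \<and>
      (1 - \<epsilon>) * q2 - \<epsilon> * q1 = CL / 2} (F p)"
      unfolding is_maximum_def
    proof safe
      show "\<exists>\<epsilon>' q1 q2. F p = 1 / (2 * pi) * (sqrt (1 - \<epsilon>') * J_max q2 + sqrt \<epsilon>' * J_max q1)\<^sup>2 \<and>
        0 \<le> \<epsilon>' \<and> \<epsilon>' < 1 \<and> 0 \<le> q1 \<and> q1 \<le> 1 / exp 1 \<and> 0 \<le> q2 \<and> q2 \<le> 1 / exp 1 \<and>
        (1 - \<epsilon>') * q2 - \<epsilon>' * q1 = CL / 2"
        using mem \<open>\<epsilon> < 1\<close> vel J_max_extremal I_functional_nonneg I_functional_le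
        by (intro exI[of _ \<epsilon>] exI[of _ "?I t1"] exI[of _ "?I t2"]) (auto simp: F_def p_eq)
    next
      fix e q1 q2 :: real
      assume e: "0 \<le> e" "e < 1" and q: "0 \<le> q1" "q1 \<le> 1 / exp 1" "0 \<le> q2" "q2 \<le> 1 / exp 1"
        and CL: "(1 - e) * q2 - e * q1 = CL / 2"
      \<comment> \<open>A triple of the reduced problem also corresponds to a point of K, with
        \<open>J_max\<close> replaced by J of the extremals, so the same maximiser p serves both
        problems.\<close>
      obtain r1 where r1: "r1 \<in> {0..1}" "?I r1 = q1"
        using ex_extremal q by metis
      obtain r2 where r2: "r2 \<in> {0..1}" "?I r2 = q2"
        using ex_extremal q by metis
      have "(e, r1, r2) \<in> K"
        using e r1 r2 CL by (auto simp: K_def B_def G_def)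
      then have "F (e, r1, r2) \<le> F p"
        by (rule p)
      moreover have "J_max q1 = ?J r1" "J_max q2 = ?J r2"
        using J_max_extremal[of r1] J_max_extremal[of r2] r1 r2 by auto
      ultimately show "1 / (2 * pi) * (sqrt (1 - e) * J_max q2 + sqrt e * J_max q1)\<^sup>2 \<le> F p"
        by (simp add: F_def)
    qed
  qed
qed

end
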